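(* Fix a feature index $j$. For each sample size $n\ge 1$ let $(B_{ij},H_{ij})$, $i=1,\dots,n$, be pairs of real random variables (whose distributions may depend on $n$; this dependence is suppressed in the notation) such that $B_{ij}\sim\mathrm{Bernoulli}(w_{ij})$ with $w_{ij}\in[0,1]$, $H_{ij}>0$ almost surely, and $E(H_{ij}^2)<\infty$. Let $T_{ij}$ be real random variables with $|T_{ij}|=(1-B_{ij})H_{ij}$, and set $$U_j=\sum_{i=1}^n |T_{ij}|=\sum_{i=1}^n (1-B_{ij})H_{ij},\qquad \mu_j=E(U_j),\qquad s_j^2=\operatorname{Var}(U_j),\qquad s_j>0.$$ Assume that for each $n$ the pairs $(B_{ij},H_{ij})$, $i=1,\dots,n$, are mutually independent, that $B_{ij}$ is independent of $H_{ij}$ for each $i$, and that for some $\delta>0$ (not depending on $n$) the Lyapunov condition $$\frac{1}{s_j^{2+\delta}}\sum_{i=1}^n E\Bigl|\,|T_{ij}|-E[|T_{ij}|]\,\Bigr|^{2+\delta}\longrightarrow 0\qquad (n\to\infty)$$ holds. Then, as $n\to\infty$, $$\frac{U_j-\mu_j}{s_j}\xrightarrow{d}N(0,1).$$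
   Context: Interpretation: $T_{ij}$ is the attribution (e.g. SHAP value) of feature $j$ at observation $i$ in a dataset of $n$ observations, modeled as a zero-inflated mixture $T_{ij}\sim w_{ij}\delta_0+(1-w_{ij})G_{ij}$, where $\delta_0$ is the point mass at $0$, $w_{ij}=\Pr(T_{ij}=0)$, and $G_{ij}$ denotes the nonzero component of $T_{ij}$. The variable $B_{ij}$ is the indicator of $T_{ij}=0$, and $H_{ij}=|G_{ij}|$ is the nonzero magnitude. $U_j$ is the aggregated feature-level attribution. Its mean and variance are given in the paper by $$\mu_j=\sum_{i=1}^n(1-w_{ij})E(H_{ij}),\qquad s_j^2=\sum_{i=1}^n(1-w_{ij})\operatorname{Var}(H_{ij})+\sum_{i=1}^n w_{ij}(1-w_{ij})\{E(H_{ij})\}^2.$$ The quantities $U_j,\mu_j,s_j$ depend on $n$, and all limits are as $n\to\infty$ with $j$ fixed. $\xrightarrow{d}$ denotes convergence in distribution, and $N(0,1)$ is the standard normal law. *)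

theory Defs
  imports "HOL-Probability.Probability"
begin

text \<open>
  Triangular arrays are indexed as \<open>T n i j\<close>: sample size \<open>n\<close>, observation \<open>i\<close>, feature \<open>j\<close>.
  The law of row \<open>n\<close> lives on its own measure space \<open>M n\<close>, so every distribution may depend on \<open>n\<close>.
\<close>

definition aggregate ::
    "(nat \<Rightarrow> nat \<Rightarrow> 'j \<Rightarrow> 'a \<Rightarrow> real) \<Rightarrow> nat \<Rightarrow> 'j \<Rightarrow> 'a \<Rightarrow> real" where
  "aggregate T n j x = (\<Sum>i=1..n. \<bar>T n i j x\<bar>)"

definition aggregate_mean ::
    "(nat \<Rightarrow> 'a measure) \<Rightarrow> (nat \<Rightarrow> nat \<Rightarrow> 'j \<Rightarrow> 'a \<Rightarrow> real) \<Rightarrow> nat \<Rightarrow> 'j \<Rightarrow> real" where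
  "aggregate_mean M T n j = prob_space.expectation (M n) (aggregate T n j)"

definition aggregate_sd ::
    "(nat \<Rightarrow> 'a measure) \<Rightarrow> (nat \<Rightarrow> nat \<Rightarrow> 'j \<Rightarrow> 'a \<Rightarrow> real) \<Rightarrow> nat \<Rightarrow> 'j \<Rightarrow> real" where
  "aggregate_sd M T n j = sqrt (prob_space.variance (M n) (aggregate T n j))"

text \<open>
  The absolute central moments are taken as nonnegative (extended) integrals: a Bochner integral
  would silently evaluate to \<open>0\<close> for a moment of order \<open>2 + \<delta>\<close> that is infinite.
\<close>

definition lyapunov_ratio ::
    "(nat \<Rightarrow> 'a measure) \<Rightarrow> (nat \<Rightarrow> nat \<Rightarrow> 'j \<Rightarrow> 'a \<Rightarrow> real) \<Rightarrow> real \<Rightarrow> nat \<Rightarrow> 'j \<Rightarrow> ennreal" where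
  "lyapunov_ratio M T \<delta> n j =
     (\<Sum>i=1..n. \<integral>\<^sup>+x. ennreal
        (\<bar>\<bar>T n i j x\<bar> - prob_space.expectation (M n) (\<lambda>y. \<bar>T n i j y\<bar>)\<bar> powr (2 + \<delta>)) \<partial>M n)
     / ennreal (aggregate_sd M T n j powr (2 + \<delta>))"

end

theory Submission imports Defs begin

text \<open>
  The magnitudes \<open>\<bar>T\<bar>\<close> agree almost surely with \<open>(1 - B) * H\<close>, which are independent within a row and
  square integrable because \<open>B\<close> takes only the values \<open>0\<close> and \<open>1\<close>; so the theorem is an instance of
  Lyapunov's central limit theorem for triangular arrays. For the latter, let \<open>Y i\<close> be the centred
  variables of a row divided by the standard deviation of the row sum, with variances \<open>v i\<close> adding
  up to \<open>1\<close> and Lyapunov ratio \<open>L\<close>. The characteristic function of the row sum and \<open>exp (-t\<^sup>2 / 2)\<close>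
  are products of factors of modulus at most \<open>1\<close>, and both \<open>i\<close>-th factors are close to
  \<open>1 - t\<^sup>2 * v i / 2\<close>. Truncating at \<open>\<bar>Y i\<bar> = \<epsilon>\<close> bounds the total error by a function of \<open>t\<close>, \<open>\<epsilon>\<close>
  and \<open>L\<close> that vanishes when first \<open>L\<close> and then \<open>\<epsilon>\<close> tends to \<open>0\<close>, for every order \<open>2 + \<delta>\<close>. Levy's
  continuity theorem concludes.
\<close>

section \<open>Elementary inequalities for truncation and for the exponential\<close>

lemma power2_le_powr_truncation:
  fixes y \<epsilon> \<delta> :: real
  assumes "\<epsilon> > 0" "\<delta> > 0" "\<bar>y\<bar> \<ge> \<epsilon>"
  shows "y\<^sup>2 \<le> \<epsilon> powr (-\<delta>) * \<bar>y\<bar> powr (2 + \<delta>)"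
proof -
  \<comment> \<open>On this range the factor
    \<open>(\<bar>y\<bar> / \<epsilon>) powr \<delta>\<close> is at least 1, so multiplying
    \<open>y\<^sup>2\<close> by it raises the order from 2 to 2 + \<delta>.\<close>
  have "\<epsilon> powr \<delta> \<le> \<bar>y\<bar> powr \<delta>"
    using assms by (intro powr_mono2) auto
  then have "1 \<le> \<epsilon> powr (-\<delta>) * \<bar>y\<bar> powr \<delta>"
    using assms by (simp add: powr_minus field_simps)
  then have "y\<^sup>2 * 1 \<le> y\<^sup>2 * (\<epsilon> powr (-\<delta>) * \<bar>y\<bar> powr \<delta>)"
    by (intro mult_left_mono) auto
  moreover have "\<bar>y\<bar> powr 2 = y\<^sup>2"
    using assms by (subst powr_numeral) auto
  ultimately show ?thesis
    by (simp add: powr_add algebra_simps)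
qed

text \<open>Splitting at the truncation level lets one bound hold for all \<open>y\<close>.
  Integrated, it makes the variances of a row uniformly small.\<close>

lemma power2_le_eps_powr:
  fixes y \<epsilon> \<delta> :: real
  assumes "\<epsilon> > 0" "\<delta> > 0"
  shows "y\<^sup>2 \<le> \<epsilon>\<^sup>2 + \<epsilon> powr (-\<delta>) * \<bar>y\<bar> powr (2 + \<delta>)"
proof (cases "\<bar>y\<bar> \<ge> \<epsilon>")
  case True
  then show ?thesis
    using power2_le_powr_truncation[OF assms] by (smt (verit) zero_le_power2)
next
  case False
  then have "y\<^sup>2 \<le> \<epsilon>\<^sup>2"
    by (simp add: abs_le_square_iff[symmetric])
  moreover have "0 \<le> \<epsilon> powr (-\<delta>) * \<bar>y\<bar> powr (2 + \<delta>)"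
    by simp
  ultimately show ?thesis
    by linarith
qed

text \<open>The left side is the integrand of the Taylor remainder in \<open>char_approx3'\<close>.
  The cubic branch serves below the level \<epsilon>, where one factor of
  \<open>\<bar>y\<bar>\<close> is at most \<epsilon>, and the quadratic branch above it. No third
  moment enters, so \<delta> may be any positive number.\<close>

lemma min_power_le_eps_powr:
  fixes t y \<epsilon> \<delta> :: real
  assumes "\<epsilon> > 0" "\<delta> > 0"
  shows "min (6 * y\<^sup>2) (\<bar>t\<bar> * \<bar>y\<bar> ^ 3)
    \<le> \<bar>t\<bar> * \<epsilon> * y\<^sup>2 + 6 * (\<epsilon> powr (-\<delta>) * \<bar>y\<bar> powr (2 + \<delta>))"
proof (cases "\<bar>y\<bar> \<ge> \<epsilon>")
  case True
  have "0 \<le> \<bar>t\<bar> * \<epsilon> * y\<^sup>2"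
    using assms by simp
  then show ?thesis
    using power2_le_powr_truncation[OF assms True] by linarith
next
  case False
  then have "\<bar>t\<bar> * y\<^sup>2 * \<bar>y\<bar> \<le> \<bar>t\<bar> * y\<^sup>2 * \<epsilon>"
    by (intro mult_left_mono) auto
  moreover have "\<bar>t\<bar> * \<bar>y\<bar> ^ 3 = \<bar>t\<bar> * y\<^sup>2 * \<bar>y\<bar>"
    by (simp add: power3_eq_cube power2_eq_square)
  moreover have "0 \<le> \<epsilon> powr (-\<delta>) * \<bar>y\<bar> powr (2 + \<delta>)"
    by simp
  moreover have "\<bar>t\<bar> * y\<^sup>2 * \<epsilon> = \<bar>t\<bar> * \<epsilon> * y\<^sup>2"
    by simp
  ultimately show ?thesis
    by linarith
qed

text \<open>One side is \<open>1 - x \<le> exp (-x)\<close>. The other,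
  \<open>exp (-x) \<le> 1 - x + x\<^sup>2 / 2\<close>, follows from the quadratic lower bound for
  \<open>exp x\<close>, because the two quadratics multiply to \<open>1 + x ^ 4 / 4\<close>, which
  is at least 1.\<close>

lemma abs_one_minus_exp_minus_le:
  fixes x :: real
  assumes "x \<ge> 0"
  shows "\<bar>1 - x - exp (-x)\<bar> \<le> x\<^sup>2 / 2"
proof -
  have "1 * exp (-x) \<le> ((1 + x + x\<^sup>2 / 2) * (1 - x + x\<^sup>2 / 2)) * exp (-x)"
  proof (intro mult_right_mono)
    have "(1 + x + x\<^sup>2 / 2) * (1 - x + x\<^sup>2 / 2) = 1 + (x\<^sup>2)\<^sup>2 / 4"
      by (simp add: field_simps power2_eq_square)
    then show "1 \<le> (1 + x + x\<^sup>2 / 2) * (1 - x + x\<^sup>2 / 2)"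
      by simp
  qed simp
  also have "\<dots> \<le> (exp x * (1 - x + x\<^sup>2 / 2)) * exp (-x)"
  proof (intro mult_right_mono)
    show "1 + x + x\<^sup>2 / 2 \<le> exp x"
      using exp_lower_Taylor_quadratic[OF assms] by simp
    have "0 \<le> (1 - x)\<^sup>2"
      by simp
    then have "2 * x \<le> 1 + x\<^sup>2"
      by (simp add: power2_diff)
    then show "0 \<le> 1 - x + x\<^sup>2 / 2"
      by linarith
  qed simp
  also have "\<dots> = 1 - x + x\<^sup>2 / 2"
    by (simp add: exp_minus)
  finally show ?thesis
    using exp_minus_ge[of x] by simp
qed

section \<open>Second moments and characteristic functions of independent sums\<close>

context prob_space
begin

lemma square_integrable_sum:
  fixes Y :: "'i \<Rightarrow> 'a \<Rightarrow> real"
  assumes "finite I" "\<And>i. i \<in> I \<Longrightarrow> random_variable borel (Y i)"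
    and "\<And>i. i \<in> I \<Longrightarrow> integrable M (\<lambda>x. (Y i x)\<^sup>2)"
  shows "integrable M (\<lambda>x. (\<Sum>i\<in>I. Y i x)\<^sup>2)"
proof -
  have "integrable M (\<lambda>x. \<Sum>i\<in>I. \<Sum>j\<in>I. Y i x * Y j x)"
  proof (intro Bochner_Integration.integrable_sum)
    fix i j assume ij: "i \<in> I" "j \<in> I"
    have [measurable]: "random_variable borel (Y i)" "random_variable borel (Y j)"
      using ij assms by auto
    show "integrable M (\<lambda>x. Y i x * Y j x)"
    \<comment> \<open>Each product in the expanded square is dominated through
      \<open>2 * a * b \<le> a\<^sup>2 + b\<^sup>2\<close>.\<close>
    proof (rule Bochner_Integration.integrable_bound)
      show "integrable M (\<lambda>x. (Y i x)\<^sup>2 + (Y j x)\<^sup>2)"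
        using ij assms by auto
      show "AE x in M. norm (Y i x * Y j x) \<le> norm ((Y i x)\<^sup>2 + (Y j x)\<^sup>2)"
      proof (rule AE_I2)
        fix x
        have "0 \<le> \<bar>Y i x\<bar> * \<bar>Y j x\<bar>"
          by simp
        then have "\<bar>Y i x * Y j x\<bar> \<le> (Y i x)\<^sup>2 + (Y j x)\<^sup>2"
          using sum_squares_bound[of "\<bar>Y i x\<bar>" "\<bar>Y j x\<bar>"]
          unfolding abs_mult power2_abs by linarith
        then show "norm (Y i x * Y j x) \<le> norm ((Y i x)\<^sup>2 + (Y j x)\<^sup>2)"
          by simp
      qed
    qed simp
  qed
  then show ?thesis
    by (simp add: power2_eq_square sum_product)
qed

lemma expectation_square_sum_indep:
  fixes Y :: "'i \<Rightarrow> 'a \<Rightarrow> real"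
  assumes "finite I" "indep_vars (\<lambda>_. borel) Y I"
    and "\<And>i. i \<in> I \<Longrightarrow> integrable M (\<lambda>x. (Y i x)\<^sup>2)"
    and "\<And>i. i \<in> I \<Longrightarrow> expectation (Y i) = 0"
  shows "expectation (\<lambda>x. (\<Sum>i\<in>I. Y i x)\<^sup>2) = (\<Sum>i\<in>I. expectation (\<lambda>x. (Y i x)\<^sup>2))"
  using assms
proof (induction I rule: finite_induct)
  case empty
  then show ?case by simp
next
  case (insert i I)
  have rv: "k \<in> insert i I \<Longrightarrow> random_variable borel (Y k)" for k
    using insert.prems(1) by (auto simp: indep_vars_def2)
  have sq: "integrable M (\<lambda>x. (\<Sum>k\<in>I. Y k x)\<^sup>2)"
    using insert by (intro square_integrable_sum rv) auto
  have [measurable]: "random_variable borel (\<lambda>x. \<Sum>k\<in>I. Y k x)"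
    using rv by (intro borel_measurable_sum) auto
  have int: "integrable M (Y i)" "integrable M (\<lambda>x. \<Sum>k\<in>I. Y k x)"
    using insert.prems(2) sq rv
    by (simp_all add: square_integrable_imp_integrable)
  have indep: "indep_var borel (Y i) borel (\<lambda>x. \<Sum>k\<in>I. Y k x)"
    using insert by (intro indep_vars_sum) auto
  \<comment> \<open>Independence factorises the cross term, and the factor
    \<open>expectation (Y i)\<close> is 0.\<close>
  have "expectation (\<lambda>x. Y i x * (\<Sum>k\<in>I. Y k x)) = 0"
    using insert.prems(3) by (simp add: indep_var_lebesgue_integral[OF indep int])
  moreover have "integrable M (\<lambda>x. Y i x * (\<Sum>k\<in>I. Y k x))"
    by (rule indep_var_integrable[OF indep int])
  moreover have "(\<Sum>k\<in>insert i I. Y k x)\<^sup>2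
      = (Y i x)\<^sup>2 + (\<Sum>k\<in>I. Y k x)\<^sup>2 + 2 * (Y i x * (\<Sum>k\<in>I. Y k x))" for x
    using insert.hyps by (simp add: power2_sum)
  moreover have "expectation (\<lambda>x. (\<Sum>k\<in>I. Y k x)\<^sup>2) = (\<Sum>k\<in>I. expectation (\<lambda>x. (Y k x)\<^sup>2))"
    using insert.prems by (intro insert.IH indep_vars_subset[OF insert.prems(1)]) auto
  ultimately show ?case
    using sq insert by simp
qed

text \<open>The term with \<open>t\<^sup>2 / 6\<close> is the Taylor error of the characteristic
  functions, the term with \<open>t ^ 4 / 8\<close> that of the Gaussian factors. The bound is
  independent of the number of summands, and taking \<open>L\<close> real forces the moments of
  order 2 + \<delta> to be finite.\<close>

lemma norm_char_sum_minus_gaussian_le: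
  fixes Y :: "'i \<Rightarrow> 'a \<Rightarrow> real"
  assumes fin: "finite I" and indep: "indep_vars (\<lambda>_. borel) Y I"
    and sq: "\<And>i. i \<in> I \<Longrightarrow> integrable M (\<lambda>x. (Y i x)\<^sup>2)"
    and mean: "\<And>i. i \<in> I \<Longrightarrow> expectation (Y i) = 0"
    and var: "(\<Sum>i\<in>I. expectation (\<lambda>x. (Y i x)\<^sup>2)) = 1"
    and L: "(\<Sum>i\<in>I. \<integral>\<^sup>+x. ennreal (\<bar>Y i x\<bar> powr (2 + \<delta>)) \<partial>M) \<le> ennreal L" "L \<ge> 0"
    and "\<epsilon> > 0" "\<delta> > 0"
  shows "cmod (char (distr M borel (\<lambda>x. \<Sum>i\<in>I. Y i x)) t - exp (-(t\<^sup>2) / 2))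
    \<le> t\<^sup>2 / 6 * (\<bar>t\<bar> * \<epsilon> + 6 * \<epsilon> powr (-\<delta>) * L) + t ^ 4 / 8 * (\<epsilon>\<^sup>2 + \<epsilon> powr (-\<delta>) * L)"
proof -
  define K where "K = \<epsilon> powr (-\<delta>)"
  define v where "v i = expectation (\<lambda>x. (Y i x)\<^sup>2)" for i
  define l where "l i = expectation (\<lambda>x. \<bar>Y i x\<bar> powr (2 + \<delta>))" for i
  define \<phi> where "\<phi> i = char (distr M borel (Y i)) t" for i
  have K: "K \<ge> 0"
    by (simp add: K_def)
  have rv[measurable]: "random_variable borel (Y i)" if "i \<in> I" for i
    using indep that by (auto simp: indep_vars_def2)
  have int: "integrable M (Y i)" if "i \<in> I" for i
    using that by (intro square_integrable_imp_integrable[OF rv sq])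
  have v_nonneg: "v i \<ge> 0" for i
    by (simp add: v_def)
  have l_nonneg: "l i \<ge> 0" for i
    by (simp add: l_def)
  \<comment> \<open>A single term of the nonnegative sum is at most the finite \<open>L\<close>.
    This gives integrability, so the Bochner moments \<open>l i\<close> are the true moments and not
    default values.\<close>
  have nn_le: "(\<integral>\<^sup>+x. ennreal (\<bar>Y i x\<bar> powr (2 + \<delta>)) \<partial>M) \<le> ennreal L" if "i \<in> I" for i
    using member_le_sum[OF that, of "\<lambda>i. \<integral>\<^sup>+x. ennreal (\<bar>Y i x\<bar> powr (2 + \<delta>)) \<partial>M"] fin L(1)
    by (auto intro: order_trans)
  have int_powr: "integrable M (\<lambda>x. \<bar>Y i x\<bar> powr (2 + \<delta>))" if "i \<in> I" for i
  proof (rule integrableI_bounded)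
    show "(\<lambda>x. \<bar>Y i x\<bar> powr (2 + \<delta>)) \<in> borel_measurable M"
      using rv[OF that] by measurable
    show "(\<integral>\<^sup>+x. ennreal (norm (\<bar>Y i x\<bar> powr (2 + \<delta>))) \<partial>M) < \<infinity>"
      using nn_le[OF that] by (simp add: le_less_trans)
  qed
  have "ennreal (\<Sum>i\<in>I. l i) = (\<Sum>i\<in>I. \<integral>\<^sup>+x. ennreal (\<bar>Y i x\<bar> powr (2 + \<delta>)) \<partial>M)"
    using int_powr by (simp add: l_def nn_integral_eq_integral l_nonneg flip: sum_ennreal)
  then have sum_l: "(\<Sum>i\<in>I. l i) \<le> L"
    using L by (metis ennreal_le_iff)
  have v_le: "v i \<le> \<epsilon>\<^sup>2 + K * L" if "i \<in> I" for i
  proof -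
    have "v i \<le> expectation (\<lambda>x. \<epsilon>\<^sup>2 + K * \<bar>Y i x\<bar> powr (2 + \<delta>))"
      unfolding v_def K_def using sq int_powr that power2_le_eps_powr[OF \<open>\<epsilon> > 0\<close> \<open>\<delta> > 0\<close>]
      by (intro integral_mono) auto
    also have "\<dots> = \<epsilon>\<^sup>2 + K * l i"
      using int_powr[OF that] by (simp add: l_def prob_space)
    also have "l i \<le> L"
      using member_le_sum[OF that, of l] fin l_nonneg sum_l by auto
    finally show ?thesis
      using K by (simp add: mult_left_mono)
  qed
  have taylor: "cmod (\<phi> i - (1 - t\<^sup>2 * v i / 2)) \<le> t\<^sup>2 / 6 * (\<bar>t\<bar> * \<epsilon> * v i + 6 * (K * l i))"
    if "i \<in> I" for i
  proof -
    \<comment> \<open>Since the mean is 0, the variance in \<open>char_approx3'\<close> is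
      \<open>v i\<close>.\<close>
    have "cmod (\<phi> i - (1 - t\<^sup>2 * v i / 2))
        \<le> t\<^sup>2 / 6 * expectation (\<lambda>x. min (6 * (Y i x)\<^sup>2) (\<bar>t\<bar> * \<bar>Y i x\<bar> ^ 3))"
      using char_approx3'[OF rv int sq mean _ refl, OF that that that that refl, of t]
        mean[OF that]
      by (simp add: \<phi>_def v_def)
    also have "expectation (\<lambda>x. min (6 * (Y i x)\<^sup>2) (\<bar>t\<bar> * \<bar>Y i x\<bar> ^ 3))
        \<le> expectation (\<lambda>x. \<bar>t\<bar> * \<epsilon> * (Y i x)\<^sup>2 + 6 * (K * \<bar>Y i x\<bar> powr (2 + \<delta>)))"
    proof (rule integral_mono)
      show "integrable M (\<lambda>x. min (6 * (Y i x)\<^sup>2) (\<bar>t\<bar> * \<bar>Y i x\<bar> ^ 3))"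
      proof (rule Bochner_Integration.integrable_bound)
        show "integrable M (\<lambda>x. 6 * (Y i x)\<^sup>2)"
          using sq[OF that] by simp
        show "(\<lambda>x. min (6 * (Y i x)\<^sup>2) (\<bar>t\<bar> * \<bar>Y i x\<bar> ^ 3)) \<in> borel_measurable M"
          using rv[OF that] by measurable
      qed simp
      show "integrable M (\<lambda>x. \<bar>t\<bar> * \<epsilon> * (Y i x)\<^sup>2 + 6 * (K * \<bar>Y i x\<bar> powr (2 + \<delta>)))"
        using sq[OF that] int_powr[OF that] by auto
    qed (unfold K_def, rule min_power_le_eps_powr[OF \<open>\<epsilon> > 0\<close> \<open>\<delta> > 0\<close>])
    also have "\<dots> = \<bar>t\<bar> * \<epsilon> * v i + 6 * (K * l i)"
      using sq[OF that] int_powr[OF that] by (simp add: v_def l_def)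
    finally show ?thesis
      by (simp add: mult_left_mono)
  qed
  have gauss: "\<bar>(1 - t\<^sup>2 * v i / 2) - exp (-(t\<^sup>2 * v i / 2))\<bar> \<le> t ^ 4 / 8 * ((\<epsilon>\<^sup>2 + K * L) * v i)"
    if "i \<in> I" for i
  proof -
    have "\<bar>(1 - t\<^sup>2 * v i / 2) - exp (-(t\<^sup>2 * v i / 2))\<bar> \<le> (t\<^sup>2 * v i / 2)\<^sup>2 / 2"
      by (rule abs_one_minus_exp_minus_le) (simp add: v_nonneg)
    also have "\<dots> = t ^ 4 / 8 * (v i * v i)"
      by (simp add: power2_eq_square power4_eq_xxxx)
    \<comment> \<open>Only one of the two factors \<open>v i\<close> is replaced by the uniform
      bound; the other is kept so that the errors can be summed using total variance 1.\<close>
    also have "\<dots> \<le> t ^ 4 / 8 * ((\<epsilon>\<^sup>2 + K * L) * v i)"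
      using v_le[OF that] v_nonneg by (intro mult_left_mono mult_right_mono) auto
    finally show ?thesis .
  qed
  have "cmod (char (distr M borel (\<lambda>x. \<Sum>i\<in>I. Y i x)) t - exp (-(t\<^sup>2) / 2))
      = cmod ((\<Prod>i\<in>I. \<phi> i) - (\<Prod>i\<in>I. complex_of_real (exp (-(t\<^sup>2 * v i / 2)))))"
  proof -
    \<comment> \<open>As the variances add up to 1, the Gaussian characteristic function splits into
      one factor per summand.\<close>
    have "(\<Prod>i\<in>I. exp (-(t\<^sup>2 * v i / 2))) = exp (\<Sum>i\<in>I. -(t\<^sup>2 / 2) * v i)"
      using fin by (simp add: exp_sum)
    also have "(\<Sum>i\<in>I. -(t\<^sup>2 / 2) * v i) = -(t\<^sup>2) / 2"
      unfolding sum_distrib_left[symmetric] using var by (simp add: v_def)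
    finally have "(\<Prod>i\<in>I. complex_of_real (exp (-(t\<^sup>2 * v i / 2)))) = complex_of_real (exp (-(t\<^sup>2) / 2))"
      by (simp only: of_real_prod[symmetric])
    then show ?thesis
      by (simp add: char_distr_sum[OF indep] \<phi>_def)
  qed
  \<comment> \<open>Telescoping: exchanging the factors one at a time costs at most the difference
    of the exchanged pair, as all other factors have modulus at most 1.\<close>
  also have "\<dots> \<le> (\<Sum>i\<in>I. cmod (\<phi> i - complex_of_real (exp (-(t\<^sup>2 * v i / 2)))))"
  proof (rule norm_prod_diff)
    show "cmod (\<phi> i) \<le> 1" if "i \<in> I" for i
      unfolding \<phi>_def
      using rv[OF that] by (intro real_distribution.cmod_char_le_1 real_distribution_distr)
  qed (simp add: v_nonneg)
  also have "\<dots> \<le> (\<Sum>i\<in>I. t\<^sup>2 / 6 * (\<bar>t\<bar> * \<epsilon> * v i + 6 * (K * l i))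
      + t ^ 4 / 8 * ((\<epsilon>\<^sup>2 + K * L) * v i))"
  proof (rule sum_mono)
    fix i assume i: "i \<in> I"
    have "cmod (\<phi> i - complex_of_real (exp (-(t\<^sup>2 * v i / 2))))
        \<le> cmod (\<phi> i - complex_of_real (1 - t\<^sup>2 * v i / 2))
          + cmod (complex_of_real ((1 - t\<^sup>2 * v i / 2) - exp (-(t\<^sup>2 * v i / 2))))"
      by (rule order_trans[OF _ norm_triangle_ineq]) simp
    also have "\<dots> \<le> t\<^sup>2 / 6 * (\<bar>t\<bar> * \<epsilon> * v i + 6 * (K * l i)) + t ^ 4 / 8 * ((\<epsilon>\<^sup>2 + K * L) * v i)"
      using taylor[OF i] gauss[OF i] unfolding norm_of_real by (intro add_mono) simp_all
    finally show "cmod (\<phi> i - complex_of_real (exp (-(t\<^sup>2 * v i / 2))))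
        \<le> t\<^sup>2 / 6 * (\<bar>t\<bar> * \<epsilon> * v i + 6 * (K * l i)) + t ^ 4 / 8 * ((\<epsilon>\<^sup>2 + K * L) * v i)" .
  qed
  also have "\<dots> = t\<^sup>2 / 6 * (\<bar>t\<bar> * \<epsilon> * (\<Sum>i\<in>I. v i) + 6 * (K * (\<Sum>i\<in>I. l i)))
      + t ^ 4 / 8 * ((\<epsilon>\<^sup>2 + K * L) * (\<Sum>i\<in>I. v i))"
    by (simp only: sum.distrib sum_distrib_left[symmetric])
  also have "\<dots> = t\<^sup>2 / 6 * (\<bar>t\<bar> * \<epsilon> + 6 * (K * (\<Sum>i\<in>I. l i))) + t ^ 4 / 8 * (\<epsilon>\<^sup>2 + K * L)"
    using var by (simp add: v_def)
  also have "\<dots> \<le> t\<^sup>2 / 6 * (\<bar>t\<bar> * \<epsilon> + 6 * (K * L)) + t ^ 4 / 8 * (\<epsilon>\<^sup>2 + K * L)"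
    using sum_l K by (intro add_right_mono mult_left_mono add_left_mono) auto
  finally show ?thesis
    by (simp add: K_def mult.assoc)
qed

end

section \<open>Lyapunov's central limit theorem for triangular arrays\<close>

theorem lyapunov_central_limit_theorem:
  fixes M :: "nat \<Rightarrow> 'a measure" and X :: "nat \<Rightarrow> 'i \<Rightarrow> 'a \<Rightarrow> real" and I :: "nat \<Rightarrow> 'i set"
    and S :: "nat \<Rightarrow> 'a \<Rightarrow> real" and s :: "nat \<Rightarrow> real" and \<delta> :: real
  defines "S \<equiv> \<lambda>n x. \<Sum>i\<in>I n. X n i x"
    and "s \<equiv> \<lambda>n. sqrt (prob_space.variance (M n) (S n))"
  assumes prob: "\<And>n. prob_space (M n)" and fin: "\<And>n. finite (I n)"
    and indep: "\<And>n. prob_space.indep_vars (M n) (\<lambda>_. borel) (X n) (I n)"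
    and sq: "\<And>n i. i \<in> I n \<Longrightarrow> integrable (M n) (\<lambda>x. (X n i x)\<^sup>2)"
    and s_pos: "\<And>n. s n > 0" and "\<delta> > 0"
    and lyapunov: "(\<lambda>n. (\<Sum>i\<in>I n. \<integral>\<^sup>+x. ennreal
          (\<bar>X n i x - prob_space.expectation (M n) (X n i)\<bar> powr (2 + \<delta>)) \<partial>M n)
        / ennreal (s n powr (2 + \<delta>))) \<longlonglongrightarrow> 0"
  shows "weak_conv_m
    (\<lambda>n. distr (M n) borel (\<lambda>x. (S n x - prob_space.expectation (M n) (S n)) / s n))
    std_normal_distribution"
proof -
  interpret prob_space "M n" for n
    by (rule prob)
  define m where "m n i = expectation n (X n i)" for n i
  define Y where "Y n i x = (X n i x - m n i) / s n" for n i x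
  \<comment> \<open>This is the Lyapunov ratio with the normalisation by \<open>s n\<close> moved
    inside the integrals, the form required by
    \<open>norm_char_sum_minus_gaussian_le\<close>.\<close>
  define \<Lambda> where "\<Lambda> n = (\<Sum>i\<in>I n. \<integral>\<^sup>+x. ennreal (\<bar>Y n i x\<bar> powr (2 + \<delta>)) \<partial>M n)" for n
  have rv[measurable]: "X n i \<in> borel_measurable (M n)" if "i \<in> I n" for n i
    using indep[of n] that by (auto simp: indep_vars_def2)
  have int: "integrable (M n) (X n i)" if "i \<in> I n" for n i
    using that by (intro square_integrable_imp_integrable[OF rv sq])
  have mean_S: "expectation n (S n) = (\<Sum>i\<in>I n. m n i)" for n
    using int by (simp add: S_def m_def)
  have S_eq: "(S n x - expectation n (S n)) / s n = (\<Sum>i\<in>I n. Y n i x)" for n x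
    unfolding mean_S by (simp add: Y_def S_def sum_subtractf flip: sum_divide_distrib)
  have indep_Y: "indep_vars n (\<lambda>_. borel) (Y n) (I n)" for n
    unfolding Y_def by (rule indep_vars_compose2[OF indep]) simp
  have rv_Y[measurable]: "Y n i \<in> borel_measurable (M n)" if "i \<in> I n" for n i
    using indep_Y[of n] that by (auto simp: indep_vars_def2)
  have sq_Y: "integrable (M n) (\<lambda>x. (Y n i x)\<^sup>2)" if "i \<in> I n" for n i
    using sq[OF that] int[OF that] by (simp add: Y_def power_divide power2_diff)
  have mean_Y: "expectation n (Y n i) = 0" if "i \<in> I n" for n i
    using int[OF that] by (simp add: Y_def[abs_def] m_def prob_space)
  have var_Y: "(\<Sum>i\<in>I n. expectation n (\<lambda>x. (Y n i x)\<^sup>2)) = 1" for n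
  proof -
    have "(\<Sum>i\<in>I n. expectation n (\<lambda>x. (Y n i x)\<^sup>2)) = expectation n (\<lambda>x. (\<Sum>i\<in>I n. Y n i x)\<^sup>2)"
      using fin indep_Y sq_Y mean_Y by (intro expectation_square_sum_indep[symmetric]) auto
    also have "\<dots> = variance n (S n) / (s n)\<^sup>2"
      by (simp add: S_eq[symmetric] power_divide)
    also have "\<dots> = 1"
      using s_pos[of n] by (simp add: s_def variance_positive)
    finally show ?thesis .
  qed
  have "\<Lambda> n = (\<Sum>i\<in>I n. \<integral>\<^sup>+x. ennreal (\<bar>X n i x - m n i\<bar> powr (2 + \<delta>)) \<partial>M n)
      / ennreal (s n powr (2 + \<delta>))" for n
  proof -
    have "(\<integral>\<^sup>+x. ennreal (\<bar>Y n i x\<bar> powr (2 + \<delta>)) \<partial>M n)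
        = (\<integral>\<^sup>+x. ennreal (\<bar>X n i x - m n i\<bar> powr (2 + \<delta>)) \<partial>M n) / ennreal (s n powr (2 + \<delta>))"
      if "i \<in> I n" for i
      using s_pos[of n] rv[OF that]
      by (subst nn_integral_divide[symmetric])
         (auto simp: Y_def powr_divide divide_ennreal intro!: nn_integral_cong)
    then show ?thesis
      by (simp add: \<Lambda>_def divide_ennreal_def sum_distrib_right)
  qed
  then have \<Lambda>_lim: "\<Lambda> \<longlonglongrightarrow> 0"
    using lyapunov unfolding m_def by presburger
  show ?thesis
  proof (rule levy_continuity)
    fix t :: real
    define bound where "bound \<epsilon> L = t\<^sup>2 / 6 * (\<bar>t\<bar> * \<epsilon> + 6 * \<epsilon> powr (-\<delta>) * L)
      + t ^ 4 / 8 * (\<epsilon>\<^sup>2 + \<epsilon> powr (-\<delta>) * L)" for \<epsilon> L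
    let ?f = "\<lambda>n. char (distr (M n) borel (\<lambda>x. (S n x - expectation n (S n)) / s n)) t"
    \<comment> \<open>Here \<open>L\<close> is any real number above \<open>\<Lambda> n\<close>, so
      it can be chosen before \<open>n\<close>.\<close>
    have *: "cmod (?f n - exp (-(t\<^sup>2) / 2)) \<le> bound \<epsilon> L"
      if "\<Lambda> n \<le> ennreal L" "L \<ge> 0" "\<epsilon> > 0" for n \<epsilon> L
      unfolding S_eq bound_def
      using that fin indep_Y sq_Y mean_Y var_Y \<open>\<delta> > 0\<close>
      by (intro norm_char_sum_minus_gaussian_le) (auto simp: \<Lambda>_def)
    have "?f \<longlonglongrightarrow> complex_of_real (exp (-(t\<^sup>2) / 2))"
      unfolding tendsto_iff
    proof (intro allI impI)
      fix r :: real assume "r > 0"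
      \<comment> \<open>At \<open>L = 0\<close> every term with
        \<open>\<epsilon> powr (-\<delta>)\<close>, which blows up as \<epsilon> tends to 0,
        disappears. Hence \<epsilon> is fixed first.\<close>
      have "((\<lambda>\<epsilon>. t\<^sup>2 / 6 * (\<bar>t\<bar> * \<epsilon>) + t ^ 4 / 8 * \<epsilon>\<^sup>2) \<longlongrightarrow> 0) (at_right 0)"
        by (auto intro!: tendsto_eq_intros)
      then have "((\<lambda>\<epsilon>. bound \<epsilon> 0) \<longlongrightarrow> 0) (at_right 0)"
        by (simp add: bound_def)
      then have "eventually (\<lambda>\<epsilon>. bound \<epsilon> 0 < r) (at_right 0)"
        using \<open>r > 0\<close> by (rule order_tendstoD)
      then have "eventually (\<lambda>\<epsilon>. bound \<epsilon> 0 < r \<and> 0 < \<epsilon>) (at_right 0)"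
        by (intro eventually_conj eventually_at_right_less)
      then obtain \<epsilon> where \<epsilon>: "\<epsilon> > 0" "bound \<epsilon> 0 < r"
        using eventually_happens'[OF trivial_limit_at_right_real] by blast
      \<comment> \<open>With \<epsilon> fixed, \<open>bound\<close> is affine in \<open>L\<close>,
        so a small positive \<open>L\<close> keeps it below \<open>r\<close>.\<close>
      have "((\<lambda>L. bound \<epsilon> L) \<longlongrightarrow> bound \<epsilon> 0) (at_right 0)"
        unfolding bound_def by (intro tendsto_intros)
      then have "eventually (\<lambda>L. bound \<epsilon> L < r) (at_right 0)"
        by (rule order_tendstoD) (rule \<epsilon>)
      then have "eventually (\<lambda>L. bound \<epsilon> L < r \<and> 0 < L) (at_right 0)"
        by (intro eventually_conj eventually_at_right_less)
      then obtain L where L: "L > 0" "bound \<epsilon> L < r"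
        using eventually_happens'[OF trivial_limit_at_right_real] by blast
      have "eventually (\<lambda>n. \<Lambda> n < ennreal L) sequentially"
        using \<Lambda>_lim by (rule order_tendstoD) (simp add: L)
      then show "eventually (\<lambda>n. dist (?f n) (complex_of_real (exp (-(t\<^sup>2) / 2))) < r) sequentially"
      proof eventually_elim
        case (elim n)
        then show ?case
          using *[of n L \<epsilon>] L \<epsilon> by (simp add: dist_norm less_imp_le)
      qed
    qed
    then show "?f \<longlonglongrightarrow> char std_normal_distribution t"
      by (simp add: char_std_normal_distribution)
  next
    show "real_distribution (distr (M n) borel (\<lambda>x. (S n x - expectation n (S n)) / s n))" for n
      unfolding S_eq using rv_Y by (intro real_distribution_distr borel_measurable_sum) auto
  qed (rule real_dist_normal_dist)
qed

section \<open>Application to zero-inflated attributions\<close>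

lemma (in prob_space) AE_bernoulli_range:
  fixes B :: "'a \<Rightarrow> real"
  assumes "random_variable borel B"
    and "distr M borel B = distr (measure_pmf (bernoulli_pmf p)) borel of_bool"
  shows "AE x in M. B x \<in> {0, 1}"
proof -
  have "AE y in distr (measure_pmf (bernoulli_pmf p)) borel of_bool. (y::real) \<in> {0, 1}"
    by (subst AE_distr_iff) (auto simp: of_bool_def)
  \<comment> \<open>Almost sure membership in a Borel set depends only on the law, so it passes from
    the Bernoulli law to \<open>B\<close>.\<close>
  then show ?thesis
    by (subst (asm) assms(2)[symmetric], subst (asm) AE_distr_iff) (use assms(1) in auto)
qed

theorem mainTheorem1:
  fixes M :: "nat \<Rightarrow> 'a measure"
    and B H T :: "nat \<Rightarrow> nat \<Rightarrow> 'j \<Rightarrow> 'a \<Rightarrow> real"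
    and w :: "nat \<Rightarrow> nat \<Rightarrow> 'j \<Rightarrow> real"
    and j :: 'j
    and \<delta> :: real
  assumes prob: "\<And>n. n \<ge> 1 \<Longrightarrow> prob_space (M n)"
    and B_rv: "\<And>n i. n \<ge> 1 \<Longrightarrow> i \<in> {1..n} \<Longrightarrow> B n i j \<in> borel_measurable (M n)"
    and H_rv: "\<And>n i. n \<ge> 1 \<Longrightarrow> i \<in> {1..n} \<Longrightarrow> H n i j \<in> borel_measurable (M n)"
    and T_rv: "\<And>n i. n \<ge> 1 \<Longrightarrow> i \<in> {1..n} \<Longrightarrow> T n i j \<in> borel_measurable (M n)"
    and w_range: "\<And>n i. n \<ge> 1 \<Longrightarrow> i \<in> {1..n} \<Longrightarrow> w n i j \<in> {0..1}"
    and B_bernoulli: "\<And>n i. n \<ge> 1 \<Longrightarrow> i \<in> {1..n} \<Longrightarrow>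
      distr (M n) borel (B n i j) = distr (measure_pmf (bernoulli_pmf (w n i j))) borel of_bool"
    and H_pos: "\<And>n i. n \<ge> 1 \<Longrightarrow> i \<in> {1..n} \<Longrightarrow> AE x in M n. H n i j x > 0"
    and H_sq: "\<And>n i. n \<ge> 1 \<Longrightarrow> i \<in> {1..n} \<Longrightarrow> integrable (M n) (\<lambda>x. (H n i j x)\<^sup>2)"
    and T_abs: "\<And>n i. n \<ge> 1 \<Longrightarrow> i \<in> {1..n} \<Longrightarrow>
      AE x in M n. \<bar>T n i j x\<bar> = (1 - B n i j x) * H n i j x"
    and sd_pos: "\<And>n. n \<ge> 1 \<Longrightarrow> aggregate_sd M T n j > 0"
    and pairs_indep: "\<And>n. n \<ge> 1 \<Longrightarrow>
      prob_space.indep_vars (M n) (\<lambda>_. borel \<Otimes>\<^sub>M borel) (\<lambda>i x. (B n i j x, H n i j x)) {1..n}"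
    and BH_indep: "\<And>n i. n \<ge> 1 \<Longrightarrow> i \<in> {1..n} \<Longrightarrow>
      prob_space.indep_var (M n) borel (B n i j) borel (H n i j)"
    and delta_pos: "\<delta> > 0"
    and lyapunov: "(\<lambda>n. lyapunov_ratio M T \<delta> n j) \<longlonglongrightarrow> 0"
  shows "weak_conv_m
    (\<lambda>n. distr (M n) borel
       (\<lambda>x. (aggregate T n j x - aggregate_mean M T n j) / aggregate_sd M T n j))
    std_normal_distribution"
proof -
  \<comment> \<open>\<open>\<bar>T\<bar>\<close> equals this product only almost surely. Working
    with the exact product makes each \<open>X n i\<close> a function of the pair
    \<open>(B, H)\<close>, so that independence within a row is inherited; expectations, variances
    and laws are then transferred along almost sure equality.\<close>
  define X where "X n i x = (1 - B n i j x) * H n i j x" for n i x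
  define S where "S n x = (\<Sum>i=1..n. X n i x)" for n x
  have rv[measurable]: "X n i \<in> borel_measurable (M n)" if "n \<ge> 1" "i \<in> {1..n}" for n i
    unfolding X_def using B_rv[OF that] H_rv[OF that] by measurable
  have T_eq: "AE x in M n. \<bar>T n i j x\<bar> = X n i x" if "n \<ge> 1" "i \<in> {1..n}" for n i
    unfolding X_def by (rule T_abs[OF that])
  have agg_eq: "AE x in M n. aggregate T n j x = S n x" if "n \<ge> 1" for n
  proof -
    \<comment> \<open>A row is finite, so the exceptional null sets can be united.\<close>
    have "AE x in M n. \<forall>i\<in>{1..n}. \<bar>T n i j x\<bar> = X n i x"
      using T_eq[OF that] by (intro AE_finite_allI) auto
    then show ?thesis
      by eventually_elim (simp add: aggregate_def S_def)
  qed
  have agg_rv: "aggregate T n j \<in> borel_measurable (M n)" if "n \<ge> 1" for n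
    unfolding aggregate_def[abs_def] using T_rv[OF that] by measurable
  have S_rv: "S n \<in> borel_measurable (M n)" if "n \<ge> 1" for n
    unfolding S_def[abs_def] using rv[OF that] by measurable
  have mean_eq: "aggregate_mean M T n j = prob_space.expectation (M n) (S n)" if "n \<ge> 1" for n
    unfolding aggregate_mean_def
    using agg_eq[OF that] agg_rv[OF that] S_rv[OF that] by (rule integral_cong_AE[rotated 2])
  have sd_eq: "aggregate_sd M T n j = sqrt (prob_space.variance (M n) (S n))" if "n \<ge> 1" for n
    unfolding aggregate_sd_def aggregate_mean_def[symmetric] mean_eq[OF that]
    using agg_eq[OF that] agg_rv[OF that] S_rv[OF that]
    by (intro arg_cong[where f = sqrt] integral_cong_AE) auto
  have distr_eq: "distr (M n) borel
        (\<lambda>x. (aggregate T n j x - aggregate_mean M T n j) / aggregate_sd M T n j)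
      = distr (M n) borel (\<lambda>x. (S n x - prob_space.expectation (M n) (S n))
          / sqrt (prob_space.variance (M n) (S n)))" if "n \<ge> 1" for n
    unfolding mean_eq[OF that] sd_eq[OF that]
    using agg_eq[OF that] agg_rv[OF that] S_rv[OF that] by (intro distr_cong_AE) auto
  have ratio_eq: "lyapunov_ratio M T \<delta> n j = (\<Sum>i=1..n. \<integral>\<^sup>+x. ennreal
        (\<bar>X n i x - prob_space.expectation (M n) (X n i)\<bar> powr (2 + \<delta>)) \<partial>M n)
      / ennreal (sqrt (prob_space.variance (M n) (S n)) powr (2 + \<delta>))" if "n \<ge> 1" for n
  proof -
    have "(\<integral>\<^sup>+x. ennreal (\<bar>\<bar>T n i j x\<bar> - prob_space.expectation (M n) (\<lambda>y. \<bar>T n i j y\<bar>)\<bar>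
          powr (2 + \<delta>)) \<partial>M n)
        = (\<integral>\<^sup>+x. ennreal (\<bar>X n i x - prob_space.expectation (M n) (X n i)\<bar> powr (2 + \<delta>)) \<partial>M n)"
      if i: "i \<in> {1..n}" for i
    proof -
      have "prob_space.expectation (M n) (\<lambda>y. \<bar>T n i j y\<bar>) = prob_space.expectation (M n) (X n i)"
        using T_eq[OF \<open>n \<ge> 1\<close> i] T_rv[OF \<open>n \<ge> 1\<close> i] rv[OF \<open>n \<ge> 1\<close> i]
        by (intro integral_cong_AE) auto
      then show ?thesis
        using T_eq[OF \<open>n \<ge> 1\<close> i] by (intro nn_integral_cong_AE) auto
    qed
    then show ?thesis
      by (simp add: lyapunov_ratio_def sd_eq[OF that])
  qed
  have sq: "integrable (M n) (\<lambda>x. (X n i x)\<^sup>2)" if n: "n \<ge> 1" and i: "i \<in> {1..n}" for n i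
  proof (rule Bochner_Integration.integrable_bound[OF H_sq[OF n i]])
    \<comment> \<open>With \<open>B\<close> in \<open>{0, 1}\<close> the product is either 0 or
      \<open>H\<close>, so its square is dominated by that of \<open>H\<close>.\<close>
    have "AE x in M n. B n i j x \<in> {0, 1}"
      using prob_space.AE_bernoulli_range[OF prob[OF n] B_rv[OF n i] B_bernoulli[OF n i]] .
    then show "AE x in M n. norm ((X n i x)\<^sup>2) \<le> norm ((H n i j x)\<^sup>2)"
      by eventually_elim (auto simp: X_def)
  qed (use rv[OF n i] in measurable)
  have indep: "prob_space.indep_vars (M n) (\<lambda>_. borel) (X n) {1..n}" if "n \<ge> 1" for n
    using prob_space.indep_vars_compose2[OF prob[OF that] pairs_indep[OF that],
        of "\<lambda>_ (b, h). (1 - b) * h" "\<lambda>_. borel"]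
    by (simp add: X_def[abs_def])
  \<comment> \<open>Nothing is assumed about \<open>M 0\<close>, hence the shift to \<open>Suc n\<close>.\<close>
  have "weak_conv_m (\<lambda>n. distr (M (Suc n)) borel
      (\<lambda>x. (S (Suc n) x - prob_space.expectation (M (Suc n)) (S (Suc n)))
        / sqrt (prob_space.variance (M (Suc n)) (S (Suc n))))) std_normal_distribution"
  proof (rule lyapunov_central_limit_theorem[where M = "\<lambda>n. M (Suc n)"
        and X = "\<lambda>n. X (Suc n)" and I = "\<lambda>n. {1..Suc n}" and \<delta> = \<delta>,
        unfolded S_def[symmetric]])
    show "(\<lambda>n. (\<Sum>i=1..Suc n. \<integral>\<^sup>+x. ennreal (\<bar>X (Suc n) i x
          - prob_space.expectation (M (Suc n)) (X (Suc n) i)\<bar> powr (2 + \<delta>)) \<partial>M (Suc n))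
        / ennreal (sqrt (prob_space.variance (M (Suc n)) (S (Suc n))) powr (2 + \<delta>))) \<longlonglongrightarrow> 0"
      using lyapunov[THEN LIMSEQ_Suc] ratio_eq by simp
    show "0 < sqrt (prob_space.variance (M (Suc n)) (S (Suc n)))" for n
      using sd_pos[of "Suc n"] sd_eq[of "Suc n"] by simp
  qed (use prob indep sq delta_pos in auto)
  then have "weak_conv_m (\<lambda>n. distr (M (Suc n)) borel
      (\<lambda>x. (aggregate T (Suc n) j x - aggregate_mean M T (Suc n) j) / aggregate_sd M T (Suc n) j))
      std_normal_distribution"
    by (simp add: distr_eq)
  then show ?thesis
    \<comment> \<open>Weak convergence unfolds to limits of distribution functions at fixed
      continuity points, and such sequential limits are unaffected by the index shift.\<close>
    unfolding weak_conv_m_def weak_conv_def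
    by (intro allI impI, subst filterlim_sequentially_Suc[symmetric]) blast
qed

end
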